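(* Let $z_k$, $k=1,\dots,K$, be independent real random variables with non-zero variances, where at most one component is Gaussian; write $\mathbf z=(z_1,\dots,z_K)^\top$. Let $\mathbf e=\mathbf D\mathbf z$, where $\mathbf D\in\mathbb R^{K\times K}$ has full rank. If a (post-hoc) linear transformation $\mathbf M\in\mathbb R^{K\times K}$ results in mutually independent components $(z'_1,\dots,z'_K)^\top=\mathbf z'=\mathbf M\mathbf e$, then $\mathbf M\mathbf e=\mathbf P\mathbf S\mathbf z$, where $\mathbf P\in\mathbb R^{K\times K}$ is a permutation matrix and $\mathbf S\in\mathbb R^{K\times K}$ is a diagonal matrix.
   Context: $K$ is a positive integer. A permutation matrix has exactly one entry $1$ in each row and each column and zeros elsewhere. $\mathbf P$ and $\mathbf S$ denote some permutation matrix and some diagonal matrix.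
   Formalization: The components of z' are also assumed to have non-zero variances (M has no zero row); otherwise M=[[1,1],[0,0]], D=I with i.i.d. non-Gaussian z is a counterexample. Variances are read as finite. *)

theory Defs
  imports "HOL-Probability.Probability"
begin

definition permutation_matrix :: "real ^ 'k ^ 'k \<Rightarrow> bool" where
  "permutation_matrix P \<longleftrightarrow>
     (\<forall>i. \<exists>!j. P $ i $ j = 1) \<and> (\<forall>j. \<exists>!i. P $ i $ j = 1) \<and>
     (\<forall>i j. P $ i $ j \<noteq> 1 \<longrightarrow> P $ i $ j = 0)"

definition diagonal_matrix :: "real ^ 'k ^ 'k \<Rightarrow> bool" where
  "diagonal_matrix S \<longleftrightarrow> (\<forall>i j. i \<noteq> j \<longrightarrow> S $ i $ j = 0)"

(* Constants are not counted as Gaussian. *)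
definition gaussian :: "'a measure \<Rightarrow> ('a \<Rightarrow> real) \<Rightarrow> bool" where
  "gaussian N X \<longleftrightarrow> (\<exists>\<mu> \<sigma>. \<sigma> > 0 \<and> distributed N lborel X (normal_density \<mu> \<sigma>))"

definition independent_components :: "'a measure \<Rightarrow> ('a \<Rightarrow> real ^ 'k) \<Rightarrow> bool" where
  "independent_components N X \<longleftrightarrow>
     prob_space.indep_vars N (\<lambda>_. borel) (\<lambda>k \<omega>. X \<omega> $ k) UNIV"

(* The Bochner integral of a non-integrable function is 0, so a non-zero value of the
   library's variance already forces the component to be square integrable.
   The theorem needs this for the transformed vector as well: constants are independent of everything,
   so M with rows (1, 1) and (0, 0) maps two independent components to two independent components,
   although it mixes them. *)
definition nonzero_variances :: "'a measure \<Rightarrow> ('a \<Rightarrow> real ^ 'k) \<Rightarrow> bool" where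
  "nonzero_variances N X \<longleftrightarrow> (\<forall>k. prob_space.variance N (\<lambda>\<omega>. X \<omega> $ k) \<noteq> 0)"

end

theory Submission
  imports Defs
begin

text \<open>
  After standardizing both vectors, the transformation becomes an orthogonal matrix \<open>Q\<close>.
  Expressing \<open>y\<^sub>j\<close> through \<open>y' = Q y\<close> and \<open>y'\<close> through \<open>y\<close>, independence of both vectors gives
  \<open>\<phi>\<^sub>j(t) = (\<Prod>i l. \<phi>\<^sub>l(Q\<^sub>i\<^sub>l Q\<^sub>i\<^sub>j t))\<close> for the characteristic functions \<open>\<phi>\<^sub>j\<close> of the \<open>y\<^sub>j\<close>.
  If column \<open>j\<close> has an entry outside \<open>{0, 1, -1}\<close>, then all nontrivial factors belong to columns of
  the same kind, at arguments at most \<open>c |t|\<close> with a uniform \<open>c < 1\<close>. The squared coefficients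
  sum to one and the standard normal characteristic function solves the same equation, so an estimate
  \<open>|\<phi>\<^sub>l(s) - exp(-s\<^sup>2/2)| \<le> \<epsilon> s\<^sup>2\<close> spreads from \<open>|s| \<le> c T\<close> to \<open>|s| \<le> T\<close>. Finite variance supplies it
  near zero for every \<open>\<epsilon> > 0\<close>, hence \<open>y\<^sub>j\<close> is Gaussian. This replaces the usual appeal to the
  Darmois--Skitovich theorem. A row with an entry outside \<open>{0, 1, -1}\<close> has at least two of them, which
  would produce two Gaussian components; hence \<open>Q\<close> is a signed permutation matrix.
\<close>

section \<open>Characteristic functions near zero\<close>

text \<open>Both functions equal \<open>1 - t\<^sup>2 / 2\<close> up to \<open>o(t\<^sup>2)\<close>.
  As only second moments are assumed, the Taylor remainder is controlled by a truncated cubic term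
  instead of a third moment.\<close>

lemma (in prob_space) char_near_gaussian:
  fixes X :: "'a \<Rightarrow> real"
  assumes [measurable]: "random_variable borel X"
    and sq: "integrable M (\<lambda>\<omega>. (X \<omega>)\<^sup>2)"
    and mean: "expectation X = 0" and var: "expectation (\<lambda>\<omega>. (X \<omega>)\<^sup>2) = 1"
    and "\<epsilon> > 0"
  shows "\<exists>d>0. \<forall>t. \<bar>t\<bar> \<le> d \<longrightarrow>
    cmod (char (distr M borel X) t - of_real (exp (- t\<^sup>2 / 2))) \<le> \<epsilon> * t\<^sup>2"
proof -
  have int: "integrable M X"
    by (rule square_integrable_imp_integrable[OF _ sq]) simp
  \<comment> \<open>Truncating at \<open>6 * (X \<omega>)\<^sup>2\<close> keeps the cubic remainder
    integrable and supplies the dominating function that makes \<open>h\<close> vanish at 0.\<close>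
  define h where "h t = expectation (\<lambda>\<omega>. min (6 * (X \<omega>)\<^sup>2) (\<bar>t\<bar> * \<bar>X \<omega>\<bar> ^ 3))" for t :: real
  have "(h \<longlongrightarrow> 0) (at 0)"
    unfolding tendsto_at_iff_sequentially comp_def
  proof (intro allI impI)
    fix u :: "nat \<Rightarrow> real" assume u: "u \<longlonglongrightarrow> 0"
    have "(\<lambda>n. min (6 * (X \<omega>)\<^sup>2) (\<bar>u n\<bar> * \<bar>X \<omega>\<bar> ^ 3)) \<longlonglongrightarrow> 0" for \<omega>
    proof -
      have "(\<lambda>n. min (6 * (X \<omega>)\<^sup>2) (\<bar>u n\<bar> * \<bar>X \<omega>\<bar> ^ 3))
          \<longlonglongrightarrow> min (6 * (X \<omega>)\<^sup>2) (\<bar>0\<bar> * \<bar>X \<omega>\<bar> ^ 3)"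
        by (intro tendsto_intros u)
      then show ?thesis by simp
    qed
    then have "(\<lambda>n. h (u n)) \<longlonglongrightarrow> (LINT \<omega>|M. 0)"
      unfolding h_def using sq
      by (intro integral_dominated_convergence[where w = "\<lambda>\<omega>. 6 * (X \<omega>)\<^sup>2"]) auto
    then show "(\<lambda>n. h (u n)) \<longlonglongrightarrow> 0" by simp
  qed
  \<comment> \<open>The Taylor bound carries the factor \<open>t\<^sup>2 / 6\<close>, so the
    threshold \<open>3 * \<epsilon>\<close> spends exactly half of the allowed error.\<close>
  then have "eventually (\<lambda>t. h t < 3 * \<epsilon>) (at 0)"
    using \<open>\<epsilon> > 0\<close> by (intro order_tendstoD) auto
  then obtain d where "d > 0" and d: "\<And>t. t \<noteq> 0 \<Longrightarrow> \<bar>t\<bar> < d \<Longrightarrow> h t < 3 * \<epsilon>"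
    unfolding eventually_at by (auto simp: dist_real_def)
  \<comment> \<open>Halving \<open>d\<close> makes the closed bound strict; the other two terms give
    \<open>t\<^sup>2 \<le> \<epsilon>\<close> below.\<close>
  define d' where "d' = min (d / 2) (min 1 \<epsilon>)"
  have "d' > 0" using \<open>d > 0\<close> \<open>\<epsilon> > 0\<close> by (simp add: d'_def)
  moreover have "cmod (char (distr M borel X) t - of_real (exp (- t\<^sup>2 / 2))) \<le> \<epsilon> * t\<^sup>2"
    if t: "\<bar>t\<bar> \<le> d'" for t
  proof (cases "t = 0")
    case True
    interpret D: real_distribution "distr M borel X" by simp
    show ?thesis by (simp add: True D.char_zero)
  next
    case False
    define v where "v = t\<^sup>2 / 2"
    have v: "v \<ge> 0" by (simp add: v_def)
    have "cmod (char (distr M borel X) t - (1 - t\<^sup>2 * 1 / 2)) \<le> t\<^sup>2 / 6 * h t"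
      unfolding h_def
      using char_approx3'[of X 1 "distr M borel X" t] int sq mean var by simp
    also have "\<dots> \<le> t\<^sup>2 / 6 * (3 * \<epsilon>)"
      using d[OF False] t \<open>d > 0\<close> by (intro mult_left_mono) (auto simp: d'_def)
    finally have 1: "cmod (char (distr M borel X) t - of_real (1 - v)) \<le> \<epsilon> / 2 * t\<^sup>2"
      by (simp add: v_def)
    \<comment> \<open>\<open>exp (- v)\<close> is enclosed between \<open>1 - v\<close> and
      \<open>1 - v + v\<^sup>2\<close>, a gap of fourth order in \<open>t\<close>.\<close>
    have lower: "1 - v \<le> exp (- v)"
      using exp_ge_add_one_self[of "- v"] by simp
    have "exp (- v) \<le> inverse (1 + v)"
      unfolding exp_minus using v exp_ge_add_one_self[of v]
      by (intro le_imp_inverse_le) auto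
    also have "\<dots> \<le> 1 - v + v\<^sup>2"
      using v by (simp add: field_simps power2_eq_square)
    finally have "\<bar>(1 - v) - exp (- v)\<bar> \<le> v\<^sup>2"
      using lower by linarith
    also have "v\<^sup>2 = t\<^sup>2 * t\<^sup>2 / 4"
      by (simp add: v_def power2_eq_square)
    also have "t\<^sup>2 \<le> \<epsilon>"
    proof -
      have "t\<^sup>2 = \<bar>t\<bar> * \<bar>t\<bar>" by (simp add: power2_eq_square)
      also have "\<dots> \<le> 1 * \<epsilon>" using t by (intro mult_mono) (auto simp: d'_def)
      finally show ?thesis by simp
    qed
    then have "t\<^sup>2 * t\<^sup>2 / 4 \<le> \<epsilon> * t\<^sup>2 / 4"
      by (intro divide_right_mono mult_right_mono) auto
    finally have "\<bar>(1 - v) - exp (- v)\<bar> \<le> \<epsilon> / 4 * t\<^sup>2" by simp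
    moreover have "\<epsilon> / 4 * t\<^sup>2 \<le> \<epsilon> / 2 * t\<^sup>2"
      using \<open>\<epsilon> > 0\<close> by (intro mult_right_mono) auto
    ultimately have 2: "cmod (of_real (1 - v) - of_real (exp (- v))) \<le> \<epsilon> / 2 * t\<^sup>2"
      unfolding of_real_diff[symmetric] norm_of_real by linarith
    have "cmod (char (distr M borel X) t - of_real (exp (- v))) \<le> \<epsilon> / 2 * t\<^sup>2 + \<epsilon> / 2 * t\<^sup>2"
      using norm_triangle_le[OF add_mono[OF 1 2]] by simp
    then show ?thesis by (simp add: v_def)
  qed
  ultimately show ?thesis by blast
qed

section \<open>The functional equation\<close>

text \<open>Purely analytic: \<open>bound\<close> controls differences of products, and
  \<open>near\<close> starts an induction over growing radii that keeps the same
  \<open>\<epsilon>\<close> at every stage.\<close>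

lemma gaussian_of_mixed_functional_equation:
  fixes \<phi> :: "'k::finite \<Rightarrow> real \<Rightarrow> complex" and Q :: "'i::finite \<Rightarrow> 'k \<Rightarrow> real"
  assumes bound: "\<And>j t. cmod (\<phi> j t) \<le> 1"
    and near: "\<And>j \<epsilon>. \<epsilon> > 0 \<Longrightarrow>
      \<exists>d>0. \<forall>t. \<bar>t\<bar> \<le> d \<longrightarrow> cmod (\<phi> j t - of_real (exp (- t\<^sup>2 / 2))) \<le> \<epsilon> * t\<^sup>2"
    and row: "\<And>i. (\<Sum>l\<in>UNIV. (Q i l)\<^sup>2) = 1"
    and col: "\<And>j. (\<Sum>i\<in>UNIV. (Q i j)\<^sup>2) = 1"
    and fun_eq: "\<And>j t. \<phi> j t = (\<Prod>i\<in>UNIV. \<Prod>l\<in>UNIV. \<phi> l (Q i l * (Q i j * t)))"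
    and mixed: "Q i0 j \<noteq> 0" "\<bar>Q i0 j\<bar> \<noteq> 1"
  shows "\<phi> j t = of_real (exp (- t\<^sup>2 / 2))"
proof -
  define J where "J = {j. \<exists>i. Q i j \<noteq> 0 \<and> \<bar>Q i j\<bar> \<noteq> 1}"
  define g :: "real \<Rightarrow> complex" where "g t = of_real (exp (- t\<^sup>2 / 2))" for t
  have g_bound: "cmod (g t) \<le> 1" for t by (simp add: g_def)
  have \<phi>0: "\<phi> l 0 = 1" for l
  proof -
    obtain d where "d > 0" "\<forall>t. \<bar>t\<bar> \<le> d \<longrightarrow> cmod (\<phi> l t - of_real (exp (- t\<^sup>2 / 2))) \<le> 1 * t\<^sup>2"
      using near[of 1 l] by auto
    from this(2)[rule_format, of 0] \<open>d > 0\<close> show ?thesis by simp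
  qed
  have le1: "\<bar>Q i l\<bar> \<le> 1" for i l
  proof -
    have "(Q i l)\<^sup>2 \<le> (\<Sum>l\<in>UNIV. (Q i l)\<^sup>2)" by (intro member_le_sum) auto
    then show ?thesis using row by (simp add: abs_square_le_1)
  qed
  have unit_row: "Q i l = 0" if "\<bar>Q i j\<bar> = 1" "l \<noteq> j" for i j l
  proof -
    have "(\<Sum>l\<in>{j, l}. (Q i l)\<^sup>2) \<le> (\<Sum>l\<in>UNIV. (Q i l)\<^sup>2)" by (intro sum_mono2) auto
    then show ?thesis using row that abs_square_eq_1[of "Q i j"] by simp
  qed
  have unit_col: "Q i' j = 0" if "\<bar>Q i j\<bar> = 1" "i' \<noteq> i" for i i' j
  proof -
    have "(\<Sum>i\<in>{i, i'}. (Q i j)\<^sup>2) \<le> (\<Sum>i\<in>UNIV. (Q i j)\<^sup>2)" by (intro sum_mono2) auto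
    then show ?thesis using col that abs_square_eq_1[of "Q i j"] by simp
  qed
  have J_less: "\<bar>Q i j\<bar> < 1" if j: "j \<in> J" for i j
  proof -
    obtain k where k: "Q k j \<noteq> 0" "\<bar>Q k j\<bar> \<noteq> 1" using j by (auto simp: J_def)
    then have "\<bar>Q i j\<bar> \<noteq> 1" using unit_col[of i j k] by metis
    then show ?thesis using le1[of i j] by linarith
  qed
  \<comment> \<open>An entry of modulus one clears the rest of its row and column, so a row that is
    nonzero in some column of \<open>J\<close> has no such entry. The equations for the columns in
    \<open>J\<close> thus form a closed system, up to factors at argument 0.\<close>
  have J_closed: "l \<in> J" if "j \<in> J" "Q i j \<noteq> 0" "Q i l \<noteq> 0" for i j l
  proof -
    have "\<bar>Q i l\<bar> \<noteq> 1"
    proof (cases "l = j")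
      case True
      then show ?thesis using J_less[OF that(1), of i] by simp
    next
      case False
      then show ?thesis using that(2) unit_row by metis
    qed
    then show ?thesis using that(3) unfolding J_def by blast
  qed
  have "j \<in> J" using mixed by (auto simp: J_def)
  \<comment> \<open>Finiteness turns the strict bounds \<open>J_less\<close> into one uniform
    contraction factor.\<close>
  define C where "C = (\<lambda>(i, j). \<bar>Q i j\<bar>) ` (UNIV \<times> J)"
  define c where "c = Max C"
  have "finite C" "C \<noteq> {}" using \<open>j \<in> J\<close> by (auto simp: C_def)
  then have "c < 1" using J_less by (auto simp: c_def C_def)
  have Q_le_c: "\<bar>Q i l\<bar> \<le> c" if "l \<in> J" for i l
    unfolding c_def using \<open>finite C\<close> that by (intro Max_ge) (auto simp: C_def)
  have "c > 0" using Q_le_c[OF \<open>j \<in> J\<close>, of i0] mixed by linarith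

  have extend: "cmod (\<phi> j t - g t) \<le> \<epsilon> * t\<^sup>2"
    if T: "\<And>l s. l \<in> J \<Longrightarrow> \<bar>s\<bar> \<le> c * T \<Longrightarrow> cmod (\<phi> l s - g s) \<le> \<epsilon> * s\<^sup>2"
      and "j \<in> J" "\<bar>t\<bar> \<le> T" "\<epsilon> > 0" for T \<epsilon> j t
  proof -
    \<comment> \<open>These are the arguments in \<open>fun_eq\<close>, indexed by pairs so that the
      double product becomes a single one.\<close>
    define a where "a p = Q (fst p) (snd p) * (Q (fst p) j * t)" for p
    have sum_a: "(\<Sum>p\<in>UNIV. (a p)\<^sup>2) = t\<^sup>2"
    proof -
      have "(\<Sum>p\<in>UNIV. (a p)\<^sup>2) = (\<Sum>i\<in>UNIV. (\<Sum>l\<in>UNIV. (Q i l)\<^sup>2) * (Q i j)\<^sup>2 * t\<^sup>2)"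
        by (simp add: a_def sum.cartesian_product' power_mult_distrib sum_distrib_right mult.assoc
            flip: UNIV_Times_UNIV)
      also have "\<dots> = (\<Sum>i\<in>UNIV. (Q i j)\<^sup>2) * t\<^sup>2"
        by (simp add: row sum_distrib_right)
      finally show ?thesis by (simp add: col)
    qed
    have "g t = of_real (exp (\<Sum>p\<in>UNIV. - (a p)\<^sup>2 / 2))"
      by (simp add: g_def sum_a sum_negf flip: sum_divide_distrib)
    also have "\<dots> = (\<Prod>p\<in>UNIV. g (a p))"
      by (simp add: exp_sum g_def)
    finally have g: "g t = (\<Prod>p\<in>UNIV. g (a p))" .
    have f: "\<phi> j t = (\<Prod>p\<in>UNIV. \<phi> (snd p) (a p))"
      by (subst fun_eq) (simp add: a_def prod.cartesian_product' flip: UNIV_Times_UNIV)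
    \<comment> \<open>With all factors of modulus at most one, the difference of two products
      telescopes into the sum of the differences of factors.\<close>
    have "cmod (\<phi> j t - g t) \<le> (\<Sum>p\<in>UNIV. cmod (\<phi> (snd p) (a p) - g (a p)))"
      unfolding f g by (rule norm_prod_diff) (auto intro: bound g_bound)
    also have "\<dots> \<le> (\<Sum>p\<in>UNIV. \<epsilon> * (a p)\<^sup>2)"
    proof (rule sum_mono)
      fix p :: "'i \<times> 'k"
      obtain i l where p: "p = (i, l)" by fastforce
      \<comment> \<open>In the first case \<open>l\<close> may lie outside \<open>J\<close>, but at
        argument 0 both functions equal 1.\<close>
      show "cmod (\<phi> (snd p) (a p) - g (a p)) \<le> \<epsilon> * (a p)\<^sup>2"
      proof (cases "Q i j = 0 \<or> Q i l = 0")
        case True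
        then have "a p = 0" by (auto simp: a_def p)
        then show ?thesis by (simp add: \<phi>0 g_def)
      next
        case False
        have "\<bar>a p\<bar> = \<bar>Q i l\<bar> * (\<bar>Q i j\<bar> * \<bar>t\<bar>)" by (simp add: a_def p abs_mult)
        also have "\<dots> \<le> 1 * (c * T)"
          using le1 Q_le_c[OF \<open>j \<in> J\<close>] \<open>\<bar>t\<bar> \<le> T\<close> \<open>c > 0\<close> by (intro mult_mono) auto
        finally show ?thesis
          using J_closed[OF \<open>j \<in> J\<close>, of i l] False T[of l "a p"] by (simp add: p)
      qed
    qed
    also have "\<dots> = \<epsilon> * t\<^sup>2"
      by (simp add: sum_a flip: sum_distrib_left)
    finally show ?thesis .
  qed

  have all_le: "cmod (\<phi> j t - g t) \<le> \<epsilon> * t\<^sup>2" if "\<epsilon> > 0" for \<epsilon>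
  proof -
    obtain d where d: "\<And>l. d l > 0"
      "\<And>l s. \<bar>s\<bar> \<le> d l \<Longrightarrow> cmod (\<phi> l s - g s) \<le> \<epsilon> * s\<^sup>2"
      using near[OF \<open>\<epsilon> > 0\<close>] unfolding g_def by metis
    define T where "T = Min (range d)"
    have "T > 0" using d(1) by (simp add: T_def)
    have T_le: "T \<le> d l" for l by (simp add: T_def)
    \<comment> \<open>Each use of \<open>extend\<close> enlarges the radius by the factor
      \<open>1 / c > 1\<close>, so every \<open>t\<close> is eventually covered.\<close>
    have iter: "\<forall>l\<in>J. \<forall>s. \<bar>s\<bar> \<le> T / c ^ n \<longrightarrow> cmod (\<phi> l s - g s) \<le> \<epsilon> * s\<^sup>2" for n
    proof (induction n)
      case 0
      then show ?case using d(2) T_le order_trans by (metis div_by_1 power_0)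
    next
      case (Suc n)
      have "c * (T / c ^ Suc n) = T / c ^ n" using \<open>c > 0\<close> by simp
      then show ?case
        using Suc extend[of "T / c ^ Suc n" \<epsilon>] that by (metis)
    qed
    \<comment> \<open>The summand 1 keeps the denominator positive when
      \<open>t = 0\<close>.\<close>
    obtain n where "c ^ n < T / (\<bar>t\<bar> + 1)"
      using real_arch_pow_inv[of "T / (\<bar>t\<bar> + 1)" c] \<open>T > 0\<close> \<open>c < 1\<close> by auto
    then have "\<bar>t\<bar> * c ^ n + c ^ n < T"
      by (simp add: pos_less_divide_eq algebra_simps)
    then have "\<bar>t\<bar> * c ^ n \<le> T"
      using zero_less_power[OF \<open>c > 0\<close>, of n] by linarith
    then have "\<bar>t\<bar> \<le> T / c ^ n"
      using \<open>c > 0\<close> by (simp add: pos_le_divide_eq)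
    then show ?thesis using iter \<open>j \<in> J\<close> by blast
  qed
  have "cmod (\<phi> j t - g t) \<le> 0"
  proof (rule field_le_epsilon)
    fix e :: real assume "e > 0"
    have pos: "0 < 1 + t\<^sup>2" by (simp add: add_pos_nonneg)
    \<comment> \<open>Scaling \<open>\<epsilon>\<close> by \<open>1 + t\<^sup>2\<close> absorbs the
      factor \<open>t\<^sup>2\<close>, again without dividing by zero.\<close>
    have "cmod (\<phi> j t - g t) \<le> e / (1 + t\<^sup>2) * t\<^sup>2"
      by (rule all_le) (use \<open>e > 0\<close> pos in simp)
    also have "\<dots> \<le> e" using \<open>e > 0\<close>
      by (simp add: pos_divide_le_eq[OF pos] algebra_simps)
    finally show "cmod (\<phi> j t - g t) \<le> 0 + e" by simp
  qed
  then show ?thesis by (simp add: g_def)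
qed

section \<open>Standardization and orthogonality\<close>

lemma (in prob_space) standardize:
  fixes X :: "'a \<Rightarrow> real"
  assumes [measurable]: "random_variable borel X" and var: "variance X \<noteq> 0"
  defines "Y \<equiv> \<lambda>\<omega>. (X \<omega> - expectation X) / sqrt (variance X)"
  shows "integrable M X" "variance X > 0" "integrable M (\<lambda>\<omega>. (Y \<omega>)\<^sup>2)"
    "expectation Y = 0" "expectation (\<lambda>\<omega>. (Y \<omega>)\<^sup>2) = 1"
proof -
  \<comment> \<open>A non-integrable square would have integral 0, contradicting
    \<open>var\<close>.\<close>
  have sq: "integrable M (\<lambda>\<omega>. (X \<omega> - expectation X)\<^sup>2)"
    using var not_integrable_integral_eq by blast
  then have int: "integrable M (\<lambda>\<omega>. X \<omega> - expectation X)"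
    by (rule square_integrable_imp_integrable[rotated]) simp
  \<comment> \<open>Until \<open>X\<close> is known to be integrable, \<open>expectation X\<close>
    is merely some constant, possibly the default 0; adding it back preserves integrability either
    way.\<close>
  then have "integrable M (\<lambda>\<omega>. (X \<omega> - expectation X) + expectation X)"
    by (intro Bochner_Integration.integrable_add) auto
  then show X: "integrable M X" by simp
  show pos: "variance X > 0"
    using var variance_positive[of X] by linarith
  have Y2: "(Y \<omega>)\<^sup>2 = (X \<omega> - expectation X)\<^sup>2 / variance X" for \<omega>
    using pos by (simp add: Y_def power_divide)
  show "integrable M (\<lambda>\<omega>. (Y \<omega>)\<^sup>2)" using sq by (simp add: Y2)
  show "expectation Y = 0" using X by (simp add: Y_def prob_space)
  show "expectation (\<lambda>\<omega>. (Y \<omega>)\<^sup>2) = 1" using pos by (simp add: Y2)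
qed

lemma (in prob_space) indep_standardized_covariance:
  fixes Y :: "'i \<Rightarrow> 'a \<Rightarrow> real"
  assumes indep: "indep_vars (\<lambda>_. borel) Y UNIV"
    and sq: "\<And>i. integrable M (\<lambda>\<omega>. (Y i \<omega>)\<^sup>2)"
    and mean: "\<And>i. expectation (Y i) = 0" and var: "\<And>i. expectation (\<lambda>\<omega>. (Y i \<omega>)\<^sup>2) = 1"
  shows "integrable M (\<lambda>\<omega>. Y i \<omega> * Y k \<omega>)"
    and "expectation (\<lambda>\<omega>. Y i \<omega> * Y k \<omega>) = (if i = k then 1 else 0)"
proof -
  have rv [measurable]: "random_variable borel (Y i)" for i
    using indep by (simp add: indep_vars_def)
  have int: "integrable M (Y i)" for i
    by (rule square_integrable_imp_integrable[OF _ sq]) simp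
  have ind: "indep_vars (\<lambda>_. borel) Y {i, k}"
    by (rule indep_vars_subset[OF indep]) simp
  show "integrable M (\<lambda>\<omega>. Y i \<omega> * Y k \<omega>)"
    using sq indep_vars_integrable[OF _ ind] int by (cases "i = k") (auto simp: power2_eq_square)
  show "expectation (\<lambda>\<omega>. Y i \<omega> * Y k \<omega>) = (if i = k then 1 else 0)"
    using var indep_vars_lebesgue_integral[OF _ ind] int mean
    by (cases "i = k") (auto simp: power2_eq_square)
qed

text \<open>Both vectors have the identity as covariance matrix, and \<open>Q\<close> carries the
  covariance \<open>I\<close> to \<open>Q I Q^T\<close>.\<close>

lemma (in prob_space) orthogonal_matrix_of_standardized:
  fixes Y Y' :: "'k::finite \<Rightarrow> 'a \<Rightarrow> real" and Q :: "real ^ 'k ^ 'k"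
  assumes Y: "indep_vars (\<lambda>_. borel) Y UNIV" "\<And>i. integrable M (\<lambda>\<omega>. (Y i \<omega>)\<^sup>2)"
      "\<And>i. expectation (Y i) = 0" "\<And>i. expectation (\<lambda>\<omega>. (Y i \<omega>)\<^sup>2) = 1"
    and Y': "indep_vars (\<lambda>_. borel) Y' UNIV" "\<And>i. integrable M (\<lambda>\<omega>. (Y' i \<omega>)\<^sup>2)"
      "\<And>i. expectation (Y' i) = 0" "\<And>i. expectation (\<lambda>\<omega>. (Y' i \<omega>)\<^sup>2) = 1"
    and lin: "\<And>i \<omega>. \<omega> \<in> space M \<Longrightarrow> Y' i \<omega> = (\<Sum>j\<in>UNIV. Q $ i $ j * Y j \<omega>)"
  shows "orthogonal_matrix Q"
proof -
  note covY = indep_standardized_covariance[OF Y]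
  note covY' = indep_standardized_covariance[OF Y']
  have "(\<Sum>j\<in>UNIV. Q $ i $ j * Q $ k $ j) = (if i = k then 1 else 0)" for i k
  proof -
    have "(if i = k then 1 else 0) = expectation (\<lambda>\<omega>. Y' i \<omega> * Y' k \<omega>)"
      by (simp add: covY')
    also have "\<dots> = expectation (\<lambda>\<omega>. \<Sum>j\<in>UNIV. \<Sum>l\<in>UNIV. (Q $ i $ j * Q $ k $ l) * (Y j \<omega> * Y l \<omega>))"
      by (intro Bochner_Integration.integral_cong refl) (simp add: lin sum_product mult_ac)
    also have "\<dots> = (\<Sum>j\<in>UNIV. \<Sum>l\<in>UNIV. (Q $ i $ j * Q $ k $ l) * (if j = l then 1 else 0))"
      by (simp add: covY Bochner_Integration.integral_sum)
    also have "\<dots> = (\<Sum>j\<in>UNIV. Q $ i $ j * Q $ k $ j)"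
      by (simp add: if_distrib sum.delta cong: if_cong)
    finally show ?thesis by simp
  qed
  then have "Q ** transpose Q = mat 1"
    by (simp add: vec_eq_iff matrix_matrix_mult_def transpose_def mat_def)
  \<comment> \<open>The criterion concerns the product in the other order; for square matrices a
    one-sided inverse is two-sided.\<close>
  then show ?thesis
    by (simp add: orthogonal_matrix matrix_left_right_inverse)
qed

section \<open>Mixed columns force normal components\<close>

lemma (in prob_space) char_distr_linear_combination:
  fixes X :: "'k::finite \<Rightarrow> 'a \<Rightarrow> real"
  assumes indep: "indep_vars (\<lambda>_. borel) X UNIV"
    and Z: "\<And>\<omega>. \<omega> \<in> space M \<Longrightarrow> Z \<omega> = (\<Sum>j\<in>UNIV. q j * X j \<omega>)"
  shows "char (distr M borel Z) t = (\<Prod>j\<in>UNIV. char (distr M borel (X j)) (q j * t))"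
proof -
  have [measurable]: "random_variable borel (X i)" for i
    using indep by (simp add: indep_vars_def)
  have "char (distr M borel Z) t = char (distr M borel (\<lambda>\<omega>. \<Sum>j\<in>UNIV. q j * X j \<omega>)) t"
    using Z by (simp cong: distr_cong)
  also have "\<dots> = (\<Prod>j\<in>UNIV. char (distr M borel (\<lambda>\<omega>. q j * X j \<omega>)) t)"
    by (intro char_distr_sum indep_vars_compose2[OF indep]) auto
  also have "\<dots> = (\<Prod>j\<in>UNIV. char (distr M borel (X j)) (q j * t))"
    by (simp add: char_def integral_distr mult_ac)
  finally show ?thesis .
qed

lemma (in prob_space) mixed_component_standard_normal:
  fixes Y Y' :: "'k::finite \<Rightarrow> 'a \<Rightarrow> real" and Q :: "real ^ 'k ^ 'k"
  assumes Y: "indep_vars (\<lambda>_. borel) Y UNIV" "\<And>i. integrable M (\<lambda>\<omega>. (Y i \<omega>)\<^sup>2)"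
      "\<And>i. expectation (Y i) = 0" "\<And>i. expectation (\<lambda>\<omega>. (Y i \<omega>)\<^sup>2) = 1"
    and Y': "indep_vars (\<lambda>_. borel) Y' UNIV"
    and Q: "orthogonal_matrix Q"
    and lin: "\<And>i \<omega>. \<omega> \<in> space M \<Longrightarrow> Y' i \<omega> = (\<Sum>j\<in>UNIV. Q $ i $ j * Y j \<omega>)"
    and mixed: "Q $ i0 $ j \<noteq> 0" "\<bar>Q $ i0 $ j\<bar> \<noteq> 1"
  shows "distributed M lborel (Y j) std_normal_density"
proof -
  have [measurable]: "random_variable borel (Y i)" for i
    using Y(1) by (simp add: indep_vars_def)
  have QQt: "(\<Sum>l\<in>UNIV. Q $ i $ l * Q $ k $ l) = (if i = k then 1 else 0)"
    and QtQ: "(\<Sum>l\<in>UNIV. Q $ l $ i * Q $ l $ k) = (if i = k then 1 else 0)" for i k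
    using Q unfolding orthogonal_matrix_def
    by (auto simp: vec_eq_iff matrix_matrix_mult_def transpose_def mat_def)
  \<comment> \<open>The transpose of \<open>Q\<close> is its inverse, so the coefficients come from
    a column.\<close>
  have inv: "Y j \<omega> = (\<Sum>i\<in>UNIV. Q $ i $ j * Y' i \<omega>)" if "\<omega> \<in> space M" for j \<omega>
  proof -
    have "(\<Sum>i\<in>UNIV. Q $ i $ j * Y' i \<omega>) =
        (\<Sum>i\<in>UNIV. \<Sum>l\<in>UNIV. Q $ i $ j * Q $ i $ l * Y l \<omega>)"
      by (simp add: lin that sum_distrib_left mult.assoc)
    also have "\<dots> = (\<Sum>l\<in>UNIV. (\<Sum>i\<in>UNIV. Q $ i $ j * Q $ i $ l) * Y l \<omega>)"
      by (subst sum.swap) (simp add: sum_distrib_right)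
    also have "\<dots> = Y j \<omega>"
      by (simp add: QtQ if_distrib[of "\<lambda>x. x * _"] sum.delta cong: if_cong)
    finally show ?thesis by simp
  qed
  have char_eq: "char (distr M borel (Y j)) t = of_real (exp (- t\<^sup>2 / 2))" for t
  proof (rule gaussian_of_mixed_functional_equation
      [where \<phi> = "\<lambda>j. char (distr M borel (Y j))" and Q = "\<lambda>i j. Q $ i $ j" and j = j and ?i0.0 = i0])
    show "cmod (char (distr M borel (Y j)) t) \<le> 1" for j t
      by (intro real_distribution.cmod_char_le_1) simp
    show "\<exists>d>0. \<forall>t. \<bar>t\<bar> \<le> d \<longrightarrow>
        cmod (char (distr M borel (Y j)) t - of_real (exp (- t\<^sup>2 / 2))) \<le> \<epsilon> * t\<^sup>2"
      if "\<epsilon> > 0" for j \<epsilon>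
      by (rule char_near_gaussian) (use Y that in auto)
    show "(\<Sum>l\<in>UNIV. (Q $ i $ l)\<^sup>2) = 1" for i using QQt[of i i] by (simp add: power2_eq_square)
    show "(\<Sum>i\<in>UNIV. (Q $ i $ j)\<^sup>2) = 1" for j using QtQ[of j j] by (simp add: power2_eq_square)
    \<comment> \<open>First \<open>Y j\<close> is split along the independent \<open>Y' i\<close>,
      then each \<open>Y' i\<close> along the independent \<open>Y l\<close>.\<close>
    show "char (distr M borel (Y j)) t =
        (\<Prod>i\<in>UNIV. \<Prod>l\<in>UNIV. char (distr M borel (Y l)) (Q $ i $ l * (Q $ i $ j * t)))" for j t
      by (simp add: char_distr_linear_combination[OF Y' inv]
          char_distr_linear_combination[OF Y(1) lin])
  qed (use mixed in auto)
  have "distr M borel (Y j) = std_normal_distribution"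
    by (rule Levy_uniqueness)
      (auto simp: char_eq char_std_normal_distribution real_dist_normal_dist)
  then show ?thesis
    by (simp add: distributed_def cong: distr_cong)
qed

section \<open>From orthogonal to signed permutation matrices\<close>

text \<open>Once every nonzero entry has modulus one, the sum of squares along a row or column
  counts its nonzero entries.\<close>

lemma orthogonal_monomial_of_card_mixed_columns:
  fixes Q :: "real ^ 'k ^ 'k"
  assumes Q: "orthogonal_matrix Q"
    and card: "card {j. \<exists>i. Q $ i $ j \<noteq> 0 \<and> \<bar>Q $ i $ j\<bar> \<noteq> 1} \<le> 1"
  shows "\<exists>!j. Q $ i $ j \<noteq> 0" and "\<exists>!i. Q $ i $ j \<noteq> 0"
proof -
  \<comment> \<open>Stated for an arbitrary matrix so that it also serves the transpose, which
    handles columns.\<close>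
  have unit: "\<exists>!j. Q $ i $ j \<noteq> 0"
    if Q: "(\<Sum>l\<in>UNIV. (Q $ i $ l)\<^sup>2) = 1" and "\<And>j. Q $ i $ j \<noteq> 0 \<Longrightarrow> \<bar>Q $ i $ j\<bar> = 1"
    for Q :: "real ^ 'k ^ 'k" and i
  proof -
    have "(Q $ i $ l)\<^sup>2 = (if Q $ i $ l \<noteq> 0 then 1 else 0)" for l
      using that(2)[of l] abs_square_eq_1[of "Q $ i $ l"] by auto
    then have "(\<Sum>l\<in>UNIV. (Q $ i $ l)\<^sup>2) = real (card {l. Q $ i $ l \<noteq> 0})"
      by (simp add: sum.If_cases)
    then have "card {l. Q $ i $ l \<noteq> 0} = 1"
      using Q by simp
    then obtain j where "{l. Q $ i $ l \<noteq> 0} = {j}" by (auto simp: card_1_singleton_iff)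
    then have "Q $ i $ l \<noteq> 0 \<longleftrightarrow> l = j" for l by blast
    then show ?thesis by simp
  qed
  have row: "(\<Sum>l\<in>UNIV. (Q $ i $ l)\<^sup>2) = 1" and col: "(\<Sum>l\<in>UNIV. (Q $ l $ i)\<^sup>2) = 1" for i
    using Q unfolding orthogonal_matrix_def
    by (auto simp: vec_eq_iff matrix_matrix_mult_def transpose_def mat_def power2_eq_square)
  have ent: "\<bar>Q $ i $ j\<bar> = 1" if nz: "Q $ i $ j \<noteq> 0" for i j
  proof (rule ccontr)
    assume j: "\<bar>Q $ i $ j\<bar> \<noteq> 1"
    have "\<exists>l. l \<noteq> j \<and> Q $ i $ l \<noteq> 0"
    proof (rule ccontr)
      assume "\<not> ?thesis"
      then have "(\<Sum>l\<in>UNIV. (Q $ i $ l)\<^sup>2) = (\<Sum>l\<in>{j}. (Q $ i $ l)\<^sup>2)"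
        by (intro sum.mono_neutral_right) auto
      then show False using row[of i] j abs_square_eq_1[of "Q $ i $ j"] by simp
    qed
    then obtain l where l: "l \<noteq> j" "Q $ i $ l \<noteq> 0" by blast
    have "(\<Sum>l\<in>{j, l}. (Q $ i $ l)\<^sup>2) \<le> (\<Sum>l\<in>UNIV. (Q $ i $ l)\<^sup>2)" by (intro sum_mono2) auto
    \<comment> \<open>A second entry of modulus one would exhaust the row sum and force
      \<open>Q $ i $ j = 0\<close>.\<close>
    then have "\<bar>Q $ i $ l\<bar> \<noteq> 1"
      using l nz row[of i] abs_square_eq_1[of "Q $ i $ l"] by (auto simp: add_nonneg_eq_0_iff)
    then have "{j, l} \<subseteq> {j. \<exists>i. Q $ i $ j \<noteq> 0 \<and> \<bar>Q $ i $ j\<bar> \<noteq> 1}"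
      using nz j l by auto
    then have "card {j, l} \<le> card {j. \<exists>i. Q $ i $ j \<noteq> 0 \<and> \<bar>Q $ i $ j\<bar> \<noteq> 1}"
      by (intro card_mono) auto
    then show False using card l by simp
  qed
  show "\<exists>!j. Q $ i $ j \<noteq> 0" using unit row ent by blast
  show "\<exists>!i. Q $ i $ j \<noteq> 0" using unit[of "transpose Q" j] col ent by (simp add: transpose_def)
qed

lemma monomial_eq_permutation_diagonal:
  fixes B :: "real ^ 'k ^ 'k"
  assumes row: "\<And>i. \<exists>!j. B $ i $ j \<noteq> 0" and col: "\<And>j. \<exists>!i. B $ i $ j \<noteq> 0"
  shows "\<exists>P S. permutation_matrix P \<and> diagonal_matrix S \<and> B = P ** S"
proof (intro exI conjI)
  let ?P = "\<chi> i j. if B $ i $ j \<noteq> 0 then 1 else (0 :: real)"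
  \<comment> \<open>The column sum picks out the single nonzero entry of column \<open>j\<close>;
    multiplying by \<open>S\<close> on the right scales columns.\<close>
  let ?S = "\<chi> i j. if i = j then \<Sum>k\<in>UNIV. B $ k $ j else 0"
  show "permutation_matrix ?P" using row col by (simp add: permutation_matrix_def)
  show "diagonal_matrix ?S" by (simp add: diagonal_matrix_def)
  have "(?P ** ?S) $ i $ j = B $ i $ j" for i j
  proof -
    have "(?P ** ?S) $ i $ j = (if B $ i $ j \<noteq> 0 then 1 else 0) * (\<Sum>k\<in>UNIV. B $ k $ j)"
      by (simp add: matrix_matrix_mult_def if_distrib[of "\<lambda>x. _ * x"] sum.delta' cong: if_cong)
    also have "\<dots> = B $ i $ j"
    proof (cases "B $ i $ j = 0")
      case False
      then have "(\<Sum>k\<in>UNIV. B $ k $ j) = (\<Sum>k\<in>{i}. B $ k $ j)"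
        using col[of j] by (intro sum.mono_neutral_right) auto
      then show ?thesis using False by simp
    qed simp
    finally show ?thesis .
  qed
  then show "B = ?P ** ?S" by (simp add: vec_eq_iff)
qed

section \<open>Unmixing up to permutation and scaling\<close>

theorem theorem3p2:
  fixes N :: "'a measure"
    and z e z' :: "'a \<Rightarrow> real ^ 'k"
    and D M :: "real ^ 'k ^ 'k"
  assumes "prob_space N"
    and "independent_components N z"
    and "nonzero_variances N z"
    and "card {k. gaussian N (\<lambda>\<omega>. z \<omega> $ k)} \<le> 1"
    and "rank D = CARD('k)"
    and "\<And>\<omega>. \<omega> \<in> space N \<Longrightarrow> e \<omega> = D *v z \<omega>"
    and "\<And>\<omega>. \<omega> \<in> space N \<Longrightarrow> z' \<omega> = M *v e \<omega>"
    and "independent_components N z'"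
    and "nonzero_variances N z'"
  shows "\<exists>P S. permutation_matrix P \<and> diagonal_matrix S \<and>
           (\<forall>\<omega>\<in>space N. M *v e \<omega> = (P ** S) *v z \<omega>)"
proof -
  interpret prob_space N by fact
  define B where "B = M ** D"
  have Me: "M *v e \<omega> = B *v z \<omega>" if "\<omega> \<in> space N" for \<omega>
    using assms(6)[OF that] by (simp add: B_def matrix_vector_mul_assoc)
  have Bz: "z' \<omega> $ i = (\<Sum>j\<in>UNIV. B $ i $ j * z \<omega> $ j)" if "\<omega> \<in> space N" for \<omega> i
    using assms(7)[OF that] Me[OF that] by (simp add: matrix_vector_mult_def)
  have ind: "indep_vars (\<lambda>_. borel) (\<lambda>k \<omega>. z \<omega> $ k) UNIV"
    and ind': "indep_vars (\<lambda>_. borel) (\<lambda>k \<omega>. z' \<omega> $ k) UNIV"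
    using assms(2,8) by (auto simp: independent_components_def)
  have rv: "random_variable borel (\<lambda>\<omega>. z \<omega> $ k)" and rv': "random_variable borel (\<lambda>\<omega>. z' \<omega> $ k)" for k
    using ind ind' by (auto simp: indep_vars_def)
  have var: "variance (\<lambda>\<omega>. z \<omega> $ k) \<noteq> 0" and var': "variance (\<lambda>\<omega>. z' \<omega> $ k) \<noteq> 0" for k
    using assms(3,9) by (auto simp: nonzero_variances_def)
  note std = standardize[OF rv var] and std' = standardize[OF rv' var']

  define m \<sigma> m' \<sigma>' where "m k = expectation (\<lambda>\<omega>. z \<omega> $ k)"
    and "\<sigma> k = sqrt (variance (\<lambda>\<omega>. z \<omega> $ k))"
    and "m' k = expectation (\<lambda>\<omega>. z' \<omega> $ k)"
    and "\<sigma>' k = sqrt (variance (\<lambda>\<omega>. z' \<omega> $ k))" for k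
  have pos: "\<sigma> k > 0" "\<sigma>' k > 0" for k
    using std(2)[of k] std'(2)[of k] by (auto simp: \<sigma>_def \<sigma>'_def)
  define Y where "Y k \<omega> = (z \<omega> $ k - m k) / \<sigma> k" for k \<omega>
  define Y' where "Y' k \<omega> = (z' \<omega> $ k - m' k) / \<sigma>' k" for k \<omega>
  have Y: "indep_vars (\<lambda>_. borel) Y UNIV" "\<And>i. integrable N (\<lambda>\<omega>. (Y i \<omega>)\<^sup>2)"
      "\<And>i. expectation (Y i) = 0" "\<And>i. expectation (\<lambda>\<omega>. (Y i \<omega>)\<^sup>2) = 1"
    using std(3-5) indep_vars_compose2[OF ind, of "\<lambda>k x. (x - m k) / \<sigma> k" "\<lambda>_. borel"]
    unfolding Y_def[abs_def] m_def \<sigma>_def by auto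
  have Y': "indep_vars (\<lambda>_. borel) Y' UNIV" "\<And>i. integrable N (\<lambda>\<omega>. (Y' i \<omega>)\<^sup>2)"
      "\<And>i. expectation (Y' i) = 0" "\<And>i. expectation (\<lambda>\<omega>. (Y' i \<omega>)\<^sup>2) = 1"
    using std'(3-5) indep_vars_compose2[OF ind', of "\<lambda>k x. (x - m' k) / \<sigma>' k" "\<lambda>_. borel"]
    unfolding Y'_def[abs_def] m'_def \<sigma>'_def by auto
  \<comment> \<open>The means obey the same linear relation, so the centered vectors are related by
    \<open>B\<close> without a shift.\<close>
  have m': "m' i = (\<Sum>j\<in>UNIV. B $ i $ j * m j)" for i
  proof -
    have "m' i = expectation (\<lambda>\<omega>. \<Sum>j\<in>UNIV. B $ i $ j * z \<omega> $ j)"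
      unfolding m'_def by (intro Bochner_Integration.integral_cong refl Bz)
    then show ?thesis using std(1) by (simp add: m_def)
  qed
  \<comment> \<open>This is \<open>B\<close> conjugated into standardized coordinates; the scale
    factors are positive, so the zero pattern is unchanged.\<close>
  define Q :: "real ^ 'k ^ 'k" where "Q = (\<chi> i j. B $ i $ j * \<sigma> j / \<sigma>' i)"
  have lin: "Y' i \<omega> = (\<Sum>j\<in>UNIV. Q $ i $ j * Y j \<omega>)" if "\<omega> \<in> space N" for i \<omega>
  proof -
    have "(\<Sum>j\<in>UNIV. Q $ i $ j * Y j \<omega>) = (\<Sum>j\<in>UNIV. B $ i $ j * (z \<omega> $ j - m j) / \<sigma>' i)"
      using pos(1) by (intro sum.cong) (auto simp: Q_def Y_def less_imp_neq[symmetric])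
    also have "\<dots> = Y' i \<omega>"
      by (simp add: Y'_def Bz[OF that] m' right_diff_distrib sum_subtractf flip: sum_divide_distrib)
    finally show ?thesis by simp
  qed
  have orth: "orthogonal_matrix Q"
    by (rule orthogonal_matrix_of_standardized[OF Y Y' lin])
  \<comment> \<open>Undoing the standardization turns standard normality into a normal law with mean
    \<open>m j\<close> and deviation \<open>\<sigma> j\<close>.\<close>
  have "gaussian N (\<lambda>\<omega>. z \<omega> $ j)" if "Q $ i $ j \<noteq> 0" "\<bar>Q $ i $ j\<bar> \<noteq> 1" for i j
  proof -
    have "distributed N lborel (\<lambda>\<omega>. (z \<omega> $ j - m j) / \<sigma> j) std_normal_density"
      using mixed_component_standard_normal[OF Y Y'(1) orth lin that] by (simp add: Y_def[abs_def])
    then show ?thesis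
      using normal_standard_normal_convert[OF pos(1)[of j]] pos(1)[of j]
      unfolding gaussian_def by blast
  qed
  then have "card {j. \<exists>i. Q $ i $ j \<noteq> 0 \<and> \<bar>Q $ i $ j\<bar> \<noteq> 1} \<le> card {k. gaussian N (\<lambda>\<omega>. z \<omega> $ k)}"
    by (intro card_mono) auto
  then have "card {j. \<exists>i. Q $ i $ j \<noteq> 0 \<and> \<bar>Q $ i $ j\<bar> \<noteq> 1} \<le> 1"
    using assms(4) by linarith
  note monomial = orthogonal_monomial_of_card_mixed_columns[OF orth this]
  have "Q $ i $ j \<noteq> 0 \<longleftrightarrow> B $ i $ j \<noteq> 0" for i j
    using pos(1)[of j] pos(2)[of i] by (simp add: Q_def)
  with monomial obtain P S where "permutation_matrix P" "diagonal_matrix S" "B = P ** S"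
    using monomial_eq_permutation_diagonal[of B] by auto
  then show ?thesis using Me by blast
qed

end
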